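(* Let $\mathcal{G}$ be the two-player augmented security game between the utility company $\mathcal{U}$ and the attacker $\mathcal{A}$ described in the context, with real parameters satisfying the standing assumptions listed there. If $$l^{\mathcal{U}}_{att\circ} - c^{\mathcal{A}}_{att\circ} > l^{\mathcal{U}}_{att} - c^{\mathcal{A}}_{att},$$ then $\mathcal{G}$ admits a unique pure Nash Equilibrium strategy profile, of the form $s^* = (s^{\mathcal{U}}_{-mon}, s^{\mathcal{A}}_{att\circ})$, and the corresponding payoffs $s^*_{\mathcal{U}} = -l^{\mathcal{U}}_{att\circ}$ (for $\mathcal{U}$) and $s^*_{\mathcal{A}} = l^{\mathcal{U}}_{att\circ} - c^{\mathcal{A}}_{att\circ}$ (for $\mathcal{A}$) are globally optimal.
   Context: The game $\mathcal{G}$ is a two-player nonzero-sum complete-information game in normal form. Player $\mathcal{U}$ (utility company) has the pure strategies $S_{\mathcal{U}} = \{s^{\mathcal{U}}_{mon}, s^{\mathcal{U}}_{-mon}\}$ (monitor, do not monitor). Player $\mathcal{A}$ (attacker) has the pure strategies $S_{\mathcal{A}} = \{s^{\mathcal{A}}_{att\circ}, s^{\mathcal{A}}_{att}, s^{\mathcal{A}}_{-att}\}$ (weak attack, strong attack, no attack). Parameters (real numbers): $c^{\mathcal{U}}_{mon}$ (monitoring cost), $c^{\mathcal{U}}_{def}$ (defence cost), $l^{\mathcal{U}}_{att\circ}$ and $l^{\mathcal{U}}_{att}$ (losses of $\mathcal{U}$ from a weak and a strong attack, assumed equal to the attacker's benefits), $c^{\mathcal{A}}_{att\circ}$ and $c^{\mathcal{A}}_{att}$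 (attacker's costs of a weak and a strong attack). Payoffs (payoff of $\mathcal{U}$, payoff of $\mathcal{A}$): - $(s^{\mathcal{U}}_{mon}, s^{\mathcal{A}}_{att\circ})$: $(-c^{\mathcal{U}}_{mon} - l^{\mathcal{U}}_{att\circ},\ l^{\mathcal{U}}_{att\circ} - c^{\mathcal{A}}_{att\circ})$ - $(s^{\mathcal{U}}_{mon}, s^{\mathcal{A}}_{att})$: $(-c^{\mathcal{U}}_{mon} - c^{\mathcal{U}}_{def},\ -c^{\mathcal{A}}_{att})$ - $(s^{\mathcal{U}}_{mon}, s^{\mathcal{A}}_{-att})$: $(-c^{\mathcal{U}}_{mon},\ 0)$ - $(s^{\mathcal{U}}_{-mon}, s^{\mathcal{A}}_{att\circ})$: $(-l^{\mathcal{U}}_{att\circ},\ l^{\mathcal{U}}_{att\circ} - c^{\mathcal{A}}_{att\circ})$ - $(s^{\mathcal{U}}_{-mon}, s^{\mathcal{A}}_{att})$: $(-l^{\mathcal{U}}_{att},\ l^{\mathcal{U}}_{att} - c^{\mathcal{A}}_{att})$ - $(s^{\mathcal{U}}_{-mon}, s^{\mathcal{A}}_{-att})$: $(0,\ 0)$ Standing assumptions: $l^{\mathcal{U}}_{att} > 0$; $c^{\mathcal{U}}_{mon} > 0$; $c^{\mathcal{A}}_{att} > 0$; $c^{\mathcal{U}}_{mon} + c^{\mathcal{U}}_{def} < l^{\mathcal{U}}_{att}$; $l^{\mathcal{U}}_{att} - c^{\mathcal{A}}_{att} > 0$; $c^{\mathcal{A}}_{att\circ} < l^{\mathcal{U}}_{att\circ}$;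 $c^{\mathcal{A}}_{att} > c^{\mathcal{A}}_{att\circ}$; $l^{\mathcal{U}}_{att} > l^{\mathcal{U}}_{att\circ}$. Terminology: with $A$ and $B$ the payoff matrices of the first and second player, an optimal Nash Equilibrium strategy profile is a strategy profile $s^*=(x^*,y^* )$ satisfying $x^*Ay^* \ge xAy^*$ for all $x$ and $x^*By^* \ge x^*By$ for all $y$; it is called pure if the strategies $x^*,y^*$ are pure. Strategies forming such a profile are called optimal strategies. The authors give no separate definition of "globally optimal"; they accompany the result with the remark that the solutions are globally optimal due to the uniqueness property. *)

theory Defs
  imports "HOL-Analysis.Analysis"
begin

section \<open>Finite two-player games in normal form (bimatrix games)\<close>

text \<open>
  The first player chooses rows, the second player chooses columns.  A strategy is a probability
  vector on the player's pure strategies; a pure strategy is identified with the corresponding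
  vertex \<open>axis i 1\<close> of the simplex.
\<close>

definition strategy :: "real ^ 'n \<Rightarrow> bool" where
  "strategy x \<longleftrightarrow> (\<forall>i. 0 \<le> x $ i) \<and> (\<Sum>i\<in>UNIV. x $ i) = 1"

definition pure_strategy :: "real ^ 'n \<Rightarrow> bool" where
  "pure_strategy x \<longleftrightarrow> (\<exists>i. x = axis i 1)"

definition expected_payoff :: "real ^ 'm ^ 'n \<Rightarrow> (real ^ 'n) \<times> (real ^ 'm) \<Rightarrow> real" where
  "expected_payoff M s = fst s \<bullet> (M *v snd s)"

definition nash_equilibrium ::
  "real ^ 'm ^ 'n \<Rightarrow> real ^ 'm ^ 'n \<Rightarrow> (real ^ 'n) \<times> (real ^ 'm) \<Rightarrow> bool" where
  "nash_equilibrium A B s \<longleftrightarrow>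
     strategy (fst s) \<and> strategy (snd s) \<and>
     (\<forall>x. strategy x \<longrightarrow> expected_payoff A (x, snd s) \<le> expected_payoff A s) \<and>
     (\<forall>y. strategy y \<longrightarrow> expected_payoff B (fst s, y) \<le> expected_payoff B s)"

definition pure_nash_equilibrium ::
  "real ^ 'm ^ 'n \<Rightarrow> real ^ 'm ^ 'n \<Rightarrow> (real ^ 'n) \<times> (real ^ 'm) \<Rightarrow> bool" where
  "pure_nash_equilibrium A B s \<longleftrightarrow>
     nash_equilibrium A B s \<and> pure_strategy (fst s) \<and> pure_strategy (snd s)"

text \<open>
  Global optimality is relative to the equilibria of the game: the payoffs are realised by an
  equilibrium (so neither player can improve by deviating to any strategy, pure or mixed), and no
  equilibrium, pure or mixed, gives either player more.  It is not maximality over all strategy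
  profiles.
\<close>

definition globally_optimal_payoffs ::
  "real ^ 'm ^ 'n \<Rightarrow> real ^ 'm ^ 'n \<Rightarrow> real \<Rightarrow> real \<Rightarrow> bool" where
  "globally_optimal_payoffs A B u v \<longleftrightarrow>
     (\<exists>s. nash_equilibrium A B s \<and> expected_payoff A s = u \<and> expected_payoff B s = v) \<and>
     (\<forall>s. nash_equilibrium A B s \<longrightarrow> expected_payoff A s \<le> u \<and> expected_payoff B s \<le> v)"

section \<open>The augmented security game\<close>

datatype utility_strategy = Mon | NoMon

datatype attacker_strategy = WeakAtt | StrongAtt | NoAtt

instance utility_strategy :: finite
proof
  have "(UNIV :: utility_strategy set) = {Mon, NoMon}"
    using utility_strategy.exhaust by auto
  then show "finite (UNIV :: utility_strategy set)"
    by (metis finite.emptyI finite_insert)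
qed

instance attacker_strategy :: finite
proof
  have "(UNIV :: attacker_strategy set) = {WeakAtt, StrongAtt, NoAtt}"
    using attacker_strategy.exhaust by auto
  then show "finite (UNIV :: attacker_strategy set)"
    by (metis finite.emptyI finite_insert)
qed

fun utility_payoff ::
  "real \<Rightarrow> real \<Rightarrow> real \<Rightarrow> real \<Rightarrow> utility_strategy \<Rightarrow> attacker_strategy \<Rightarrow> real" where
  "utility_payoff c_mon c_def l_weak l_att Mon WeakAtt = - c_mon - l_weak"
| "utility_payoff c_mon c_def l_weak l_att Mon StrongAtt = - c_mon - c_def"
| "utility_payoff c_mon c_def l_weak l_att Mon NoAtt = - c_mon"
| "utility_payoff c_mon c_def l_weak l_att NoMon WeakAtt = - l_weak"
| "utility_payoff c_mon c_def l_weak l_att NoMon StrongAtt = - l_att"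
| "utility_payoff c_mon c_def l_weak l_att NoMon NoAtt = 0"

fun attacker_payoff ::
  "real \<Rightarrow> real \<Rightarrow> real \<Rightarrow> real \<Rightarrow> utility_strategy \<Rightarrow> attacker_strategy \<Rightarrow> real" where
  "attacker_payoff l_weak l_att c_weak c_att Mon WeakAtt = l_weak - c_weak"
| "attacker_payoff l_weak l_att c_weak c_att Mon StrongAtt = - c_att"
| "attacker_payoff l_weak l_att c_weak c_att Mon NoAtt = 0"
| "attacker_payoff l_weak l_att c_weak c_att NoMon WeakAtt = l_weak - c_weak"
| "attacker_payoff l_weak l_att c_weak c_att NoMon StrongAtt = l_att - c_att"
| "attacker_payoff l_weak l_att c_weak c_att NoMon NoAtt = 0"

definition utility_matrix ::
  "real \<Rightarrow> real \<Rightarrow> real \<Rightarrow> real \<Rightarrow> real ^ attacker_strategy ^ utility_strategy" where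
  "utility_matrix c_mon c_def l_weak l_att =
     (\<chi> i j. utility_payoff c_mon c_def l_weak l_att i j)"

definition attacker_matrix ::
  "real \<Rightarrow> real \<Rightarrow> real \<Rightarrow> real \<Rightarrow> real ^ attacker_strategy ^ utility_strategy" where
  "attacker_matrix l_weak l_att c_weak c_att =
     (\<chi> i j. attacker_payoff l_weak l_att c_weak c_att i j)"

end

theory Submission
  imports Defs
begin

text \<open>
  Under the hypothesis the weak attack strictly dominates the attacker's other pure strategies, so
  it is the only best reply to any mixed strategy of the utility company; against the weak attack,
  not monitoring is strictly better.  A game solved in this way by strict dominance has exactly one
  equilibrium, even among mixed strategies.
\<close>

lemma strategy_axis: "strategy (axis i 1)"
  by (simp add: strategy_def axis_def)

text \<open>\<open>p \<bullet> w\<close> is a weighted average of the entries of \<open>w\<close>.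
  Any \<open>p\<close> other than the vertex at \<open>j\<close> puts positive weight on some other
  entry, which pulls the average below the strict maximum \<open>w $ j\<close>.\<close>

lemma strategy_inner_less:
  fixes p w :: "real ^ 'n"
  assumes p: "strategy p" and w: "\<And>k. k \<noteq> j \<Longrightarrow> w $ k < w $ j" and ne: "p \<noteq> axis j 1"
  shows "p \<bullet> w < w $ j"
proof -
  have nn: "\<And>k. 0 \<le> p $ k" and sum1: "(\<Sum>k\<in>UNIV. p $ k) = 1"
    using p by (auto simp: strategy_def)
  have "\<exists>k. k \<noteq> j \<and> p $ k \<noteq> 0"
  proof (rule ccontr)
    assume "\<not> ?thesis"
    then have z: "p $ k = 0" if "k \<noteq> j" for k using that by auto
    have "(\<Sum>k\<in>UNIV. p $ k) = p $ j + (\<Sum>k\<in>UNIV - {j}. p $ k)"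
      by (simp add: sum.remove)
    then have "p $ j = 1" using sum1 z by simp
    then have "p = axis j 1" using z by (simp add: vec_eq_iff axis_def)
    with ne show False ..
  qed
  then obtain k where k: "k \<noteq> j" "0 < p $ k" using nn by (metis order_le_less)
  have "w $ l \<le> w $ j" for l using w[of l] by (cases "l = j") auto
  \<comment> \<open>The right-hand side is the average of the constant \<open>w $ j\<close>; the
    comparison is termwise, and strict at \<open>k\<close>.\<close>
  then have "p \<bullet> w < (\<Sum>l\<in>UNIV. p $ l * w $ j)"
    unfolding inner_vec_def inner_real_def
    using mult_strict_left_mono[OF w[OF k(1)] k(2)] nn
    by (intro sum_strict_mono_ex1) (auto intro: mult_left_mono)
  then show ?thesis by (simp add: sum1 flip: sum_distrib_right)
qed

lemma strategy_inner_le: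
  fixes p w :: "real ^ 'n"
  assumes "strategy p" and "\<And>k. k \<noteq> j \<Longrightarrow> w $ k < w $ j"
  shows "p \<bullet> w \<le> w $ j"
  using strategy_inner_less[OF assms] by (cases "p = axis j 1") (auto simp: inner_axis')

text \<open>\<open>x v* B\<close> lists the payoffs of the pure columns against \<open>x\<close>.
  Averaging the rowwise inequalities with the weights of \<open>x\<close> keeps them strict, since
  some weight is positive.\<close>

lemma vector_matrix_mult_strict_mono:
  fixes x :: "real ^ 'n" and B :: "real ^ 'm ^ 'n"
  assumes x: "strategy x" and B: "\<And>i. B $ i $ k < B $ i $ j"
  shows "(x v* B) $ k < (x v* B) $ j"
proof -
  have nn: "0 \<le> x $ i" for i using x by (simp add: strategy_def)
  have "\<exists>i. x $ i \<noteq> 0"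
    using x by (metis strategy_def sum.neutral zero_neq_one)
  then obtain i where "0 < x $ i" using nn by (metis order_le_less)
  then have "B $ i $ k * x $ i < B $ i $ j * x $ i"
    using B by simp
  then show ?thesis
    unfolding vector_matrix_mult_def vec_lambda_beta
    using nn less_imp_le[OF B]
    by (intro sum_strict_mono_ex1) (auto intro: mult_left_mono simp: mult.commute)
qed

text \<open>Puts the second player's strategy on the left of the inner product, so that the bounds
  on averages apply to that player too.\<close>

lemma expected_payoff_column: "expected_payoff M (x, y) = y \<bullet> (x v* M)"
  by (simp add: expected_payoff_def dot_lmul_matrix inner_commute[of y])

lemma expected_payoff_axis: "expected_payoff M (axis i 1, axis j 1) = M $ i $ j"
  by (simp add: expected_payoff_def inner_axis' matrix_vector_mult_basis column_def)

lemma nash_equilibrium_iff_strictly_dominant: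
  fixes A B :: "real ^ 'm ^ 'n"
  assumes B: "\<And>k l. l \<noteq> j \<Longrightarrow> B $ k $ l < B $ k $ j"
    and A: "\<And>k. k \<noteq> i \<Longrightarrow> A $ k $ j < A $ i $ j"
  shows "nash_equilibrium A B s \<longleftrightarrow> s = (axis i 1, axis j 1)"
proof -
  have col: "(A *v axis j 1) $ k = A $ k $ j" for k
    by (simp add: matrix_vector_mult_basis column_def)
  have w: "(x v* B) $ l < (x v* B) $ j" if "strategy x" "l \<noteq> j" for x l
    using vector_matrix_mult_strict_mono[OF that(1) B[OF that(2)]] .
  show ?thesis
  proof
    assume ne: "nash_equilibrium A B s"
    obtain x y where s: "s = (x, y)" by (cases s)
    have x: "strategy x" and y: "strategy y"
      and optx: "\<And>x'. strategy x' \<Longrightarrow> expected_payoff A (x', y) \<le> expected_payoff A (x, y)"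
      and opty: "\<And>y'. strategy y' \<Longrightarrow> expected_payoff B (x, y') \<le> expected_payoff B (x, y)"
      using ne by (auto simp: nash_equilibrium_def s)
    \<comment> \<open>\<open>y\<close> is settled first: column \<open>j\<close> is the unique best
      reply whatever \<open>x\<close> is, whereas row \<open>i\<close> is known to be best only
      against column \<open>j\<close>.\<close>
    have "y = axis j 1"
    proof (rule ccontr)
      assume "y \<noteq> axis j 1"
      then have "y \<bullet> (x v* B) < (x v* B) $ j"
        using strategy_inner_less[OF y w[OF x]] by blast
      with opty[OF strategy_axis[of j]] show False
        by (simp add: expected_payoff_column inner_axis')
    qed
    moreover have "x = axis i 1"
    proof (rule ccontr)
      assume "x \<noteq> axis i 1"
      then have "x \<bullet> (A *v axis j 1) < (A *v axis j 1) $ i"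
        by (intro strategy_inner_less[OF x]) (simp_all add: col A)
      with optx[OF strategy_axis[of i]] show False
        by (simp add: \<open>y = axis j 1\<close> expected_payoff_def inner_axis')
    qed
    ultimately show "s = (axis i 1, axis j 1)" by (simp add: s)
  next
    assume s: "s = (axis i 1, axis j 1)"
    have "expected_payoff A (x, axis j 1) \<le> A $ i $ j" if "strategy x" for x
      using strategy_inner_le[OF that, where j = i and w = "A *v axis j 1"]
      by (simp add: expected_payoff_def col A)
    moreover have "expected_payoff B (axis i 1, y) \<le> expected_payoff B s" if "strategy y" for y
      using strategy_inner_le[OF that w[OF strategy_axis]]
      by (simp add: expected_payoff_column s inner_axis')
    ultimately show "nash_equilibrium A B s"
      by (simp add: nash_equilibrium_def s strategy_axis expected_payoff_axis)
  qed
qed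

theorem mainTheorem1:
  fixes c_mon c_def l_weak l_att c_weak c_att :: real
    and A B :: "real ^ attacker_strategy ^ utility_strategy"
    and s_star :: "(real ^ utility_strategy) \<times> (real ^ attacker_strategy)"
  defines "A \<equiv> utility_matrix c_mon c_def l_weak l_att"
    and "B \<equiv> attacker_matrix l_weak l_att c_weak c_att"
    and "s_star \<equiv> (axis NoMon 1, axis WeakAtt 1)"
  assumes "l_att > 0"
    and "c_mon > 0"
    and "c_att > 0"
    and "c_mon + c_def < l_att"
    and "l_att - c_att > 0"
    and "c_weak < l_weak"
    and "c_att > c_weak"
    and "l_att > l_weak"
    and "l_weak - c_weak > l_att - c_att"
  shows "pure_nash_equilibrium A B s_star \<and>
         (\<exists>!s. pure_nash_equilibrium A B s) \<and>
         (\<exists>!s. nash_equilibrium A B s) \<and>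
         expected_payoff A s_star = - l_weak \<and>
         expected_payoff B s_star = l_weak - c_weak \<and>
         globally_optimal_payoffs A B (- l_weak) (l_weak - c_weak)"
proof -
  \<comment> \<open>The strict hypothesis on net gains settles \<open>StrongAtt\<close> against
    \<open>NoMon\<close>; the remaining cases follow from \<open>c_weak < l_weak\<close> and
    \<open>c_att > 0\<close>.\<close>
  have B: "B $ k $ l < B $ k $ WeakAtt" if "l \<noteq> WeakAtt" for k l
    using assms that by (cases k; cases l) (auto simp: attacker_matrix_def)
  \<comment> \<open>Monitoring does not reduce the loss from a weak attack, so the gap is exactly
    \<open>c_mon\<close>.\<close>
  have A: "A $ k $ WeakAtt < A $ NoMon $ WeakAtt" if "k \<noteq> NoMon" for k
    using assms that by (cases k) (auto simp: utility_matrix_def)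
  have nash: "nash_equilibrium A B s \<longleftrightarrow> s = s_star" for s
    unfolding s_star_def by (rule nash_equilibrium_iff_strictly_dominant[OF B A])
  have pure: "pure_nash_equilibrium A B s \<longleftrightarrow> s = s_star" for s
    by (auto simp: pure_nash_equilibrium_def nash pure_strategy_def s_star_def)
  have payoffs: "expected_payoff A s_star = - l_weak" "expected_payoff B s_star = l_weak - c_weak"
    by (simp_all add: s_star_def expected_payoff_axis A_def B_def utility_matrix_def
        attacker_matrix_def)
  show ?thesis
    \<comment> \<open>Since \<open>s_star\<close> is the only equilibrium, mixed ones included, it
      both attains the payoffs and is the only profile to be bounded by them.\<close>
    unfolding globally_optimal_payoffs_def nash pure by (blast intro: payoffs eq_refl)
qed

end
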